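(* For each Sturmian permutation $\alpha$ we have $p^*_{\alpha}(n)=n$ for every integer $n\ge 1$.
   Context: $\mathbb N=\{0,1,2,\dots\}$. An infinite permutation (or $\mathbb N$-permutation) $\alpha$ is an equivalence class of sequences $(a_s)_{s\in\mathbb N}$ of pairwise distinct real numbers, where $(a_s)\sim(b_s)$ if and only if for all $s,r\in\mathbb N$ one has $a_s<a_r \iff b_s<b_r$. Equivalently, it is a linear ordering of the index set $\mathbb N$. The class of a sequence $a$ is denoted $\overline a$. A window is a finite set $T=\{0,m_1,\dots,m_{k-1}\}\subset\mathbb N$ with $0<m_1<\dots<m_{k-1}$; $\#T=k$. For $n\in\mathbb N$ the $T$-factor $\alpha_{T+n}$ is the restriction of $\alpha$ to $T+n$, regarded as a permutation on $T$ (via the shift by $n$). The number of distinct $T$-factors of $\alpha$ is denoted $p_\alpha(T)$, and the maximal pattern complexity of $\alpha$ is $p^*_\alpha(n)=\max_{\#T=n}p_\alpha(T)$. A one-sided infinite word $w=w_0w_1w_2\cdots$ on $\{0,1\}$ is Sturmian if for every $n$ it has exactly $n+1$ distinct factors (blocks of consecutive letters) of length $n$. Sturmian permutations: let $w$ be a Sturmian word on $\{0,1\}$ and let $x,y>0$ be real numbers such that $kx\neq ly$ whenever $k$ is the number of $0$'s and $l$ is the number of $1$'s in some nonempty factor of $w$. Let $a_0$ be any real number and, for $i\ge0$, let $a_{i+1}=a_i+x$ if $w_i=0$ and $a_{i+1}=a_i-y$ if $w_i=1$. The $a_i$ are pairwise distinct, and the Sturmian permutation associated with $w,x,y$ is $\alpha(w,x,y)=\overline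 a$. A Sturmian permutation is any permutation of the form $\alpha(w,x,y)$. *)

theory Defs
  imports Complex_Main
begin

text \<open>
  A permutation on an index set \<open>I\<close> is an equivalence class of sequences that are injective on
  \<open>I\<close>.  Sequences are total functions on the naturals; since the relation ignores all values
  outside \<open>I\<close>, the classes correspond to classes of real-valued families indexed by \<open>I\<close>.
  The infinite permutations are the elements of \<open>perms UNIV\<close>.
\<close>

definition perm_rel :: "nat set \<Rightarrow> ((nat \<Rightarrow> real) \<times> (nat \<Rightarrow> real)) set" where
  "perm_rel I = {(a, b). inj_on a I \<and> inj_on b I \<and>
     (\<forall>s\<in>I. \<forall>r\<in>I. a s < a r \<longleftrightarrow> b s < b r)}"

definition perms :: "nat set \<Rightarrow> (nat \<Rightarrow> real) set set" where
  "perms I = {a. inj_on a I} // perm_rel I"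

definition perm_class :: "nat set \<Rightarrow> (nat \<Rightarrow> real) \<Rightarrow> (nat \<Rightarrow> real) set" where
  "perm_class I a = perm_rel I `` {a}"

lemma equiv_perm_rel: "equiv {a. inj_on a I} (perm_rel I)"
  by (rule equivI) (auto simp: perm_rel_def refl_on_def sym_def trans_def)

lemma perm_class_in_perms: "inj_on a I \<Longrightarrow> perm_class I a \<in> perms I"
  by (auto simp: perm_class_def perms_def intro: quotientI)

lemma permsE:
  assumes "\<alpha> \<in> perms I"
  obtains a where "inj_on a I" "\<alpha> = perm_class I a"
  using assms by (auto simp: perm_class_def perms_def elim: quotientE)

lemma perm_class_eq_iff:
  assumes "inj_on a I" "inj_on b I"
  shows "perm_class I a = perm_class I b \<longleftrightarrow> (\<forall>s\<in>I. \<forall>r\<in>I. a s < a r \<longleftrightarrow> b s < b r)"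
  using eq_equiv_class_iff[OF equiv_perm_rel, of a I b] assms
  by (simp add: perm_class_def) (simp add: perm_rel_def)

definition window :: "nat set \<Rightarrow> bool" where
  "window T \<longleftrightarrow> finite T \<and> 0 \<in> T"

text \<open>
  The factor is defined through all representatives of the class; \<open>perm_factor_perm_class\<close>
  below shows that it does not depend on the representative.
\<close>

definition perm_factor :: "(nat \<Rightarrow> real) set \<Rightarrow> nat set \<Rightarrow> nat \<Rightarrow> (nat \<Rightarrow> real) set" where
  "perm_factor \<alpha> T n = (\<Union>a\<in>\<alpha>. perm_class T (\<lambda>t. a (t + n)))"

definition perm_complexity :: "(nat \<Rightarrow> real) set \<Rightarrow> nat set \<Rightarrow> nat" where
  "perm_complexity \<alpha> T = card {perm_factor \<alpha> T n | n. True}"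

definition max_pattern_complexity :: "(nat \<Rightarrow> real) set \<Rightarrow> nat \<Rightarrow> nat" where
  "max_pattern_complexity \<alpha> n = Max {perm_complexity \<alpha> T | T. window T \<and> card T = n}"

lemma inj_on_shift: "inj a \<Longrightarrow> inj_on (\<lambda>t. a (t + n)) (T :: nat set)"
  by (rule inj_onI) (metis add_right_cancel injD)

lemma perm_factor_perm_class:
  assumes "inj a"
  shows "perm_factor (perm_class UNIV a) T n = perm_class T (\<lambda>t. a (t + n))"
proof -
  have "perm_class T (\<lambda>t. b (t + n)) = perm_class T (\<lambda>t. a (t + n))"
    if "b \<in> perm_class UNIV a" for b
  proof -
    from that have "inj b" "\<And>s r. a s < a r \<longleftrightarrow> b s < b r"
      by (auto simp: perm_class_def perm_rel_def)
    with assms show ?thesis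
      by (subst perm_class_eq_iff) (auto intro: inj_on_shift)
  qed
  moreover have "a \<in> perm_class UNIV a"
    using assms by (auto simp: perm_class_def perm_rel_def)
  ultimately show ?thesis
    unfolding perm_factor_def by blast
qed

text \<open>
  The cardinality and the maximum above are taken over finite sets, and the maximum over a
  nonempty one for positive \<open>n\<close>.
\<close>

lemma perm_factors_bound:
  assumes "\<alpha> \<in> perms UNIV" "finite T"
  shows "finite {perm_factor \<alpha> T n | n. True}"
    and "perm_complexity \<alpha> T \<le> 2 ^ (card T * card T)"
proof -
  obtain a where a: "inj a" "\<alpha> = perm_class UNIV a"
    using assms(1) by (rule permsE)
  define R where "R n = {(s, r) \<in> T \<times> T. a (s + n) < a (r + n)}" for n
  define F where "F n = perm_factor \<alpha> T n" for n
  have F_eq: "F n = F m" if "R n = R m" for n m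
  proof -
    have "\<forall>s\<in>T. \<forall>r\<in>T. a (s + n) < a (r + n) \<longleftrightarrow> a (s + m) < a (r + m)"
      using that by (auto simp: R_def set_eq_iff)
    then show ?thesis
      unfolding F_def a(2) perm_factor_perm_class[OF a(1)]
      by (subst perm_class_eq_iff) (auto intro: inj_on_shift a(1))
  qed
  have fact: "range F = (\<lambda>r. F (SOME n. R n = r)) ` range R"
  proof -
    have "F n = F (SOME m. R m = R n)" for n
      by (rule F_eq) (metis (mono_tags, lifting) someI)
    then show ?thesis by (auto simp: image_image)
  qed
  have sub: "range R \<subseteq> Pow (T \<times> T)" by (auto simp: R_def)
  have fin: "finite (Pow (T \<times> T))" using assms(2) by simp
  have set: "{perm_factor \<alpha> T n | n. True} = range F" by (auto simp: F_def)
  show "finite {perm_factor \<alpha> T n | n. True}"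
    unfolding set fact using finite_subset[OF sub fin] by simp
  have "card (range F) \<le> card (range R)"
    unfolding fact using finite_subset[OF sub fin] by (rule card_image_le)
  also have "\<dots> \<le> card (Pow (T \<times> T))" using fin sub by (rule card_mono)
  also have "\<dots> = 2 ^ (card T * card T)"
    using assms(2) by (simp add: card_Pow card_cartesian_product)
  finally show "perm_complexity \<alpha> T \<le> 2 ^ (card T * card T)"
    unfolding perm_complexity_def set .
qed

lemma finite_perm_complexities:
  assumes "\<alpha> \<in> perms UNIV"
  shows "finite {perm_complexity \<alpha> T | T. window T \<and> card T = n}"
  by (rule finite_subset[of _ "{..2 ^ (n * n)}"])
    (use perm_factors_bound(2)[OF assms] in \<open>auto simp: window_def\<close>)

lemma perm_complexities_nonempty:
  assumes "n \<ge> 1"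
  shows "{perm_complexity \<alpha> T | T. window T \<and> card T = n} \<noteq> {}"
proof -
  have "window {..<n}" "card {..<n} = n" using assms by (auto simp: window_def)
  then show ?thesis by blast
qed

definition word_factors :: "(nat \<Rightarrow> 'a) \<Rightarrow> nat \<Rightarrow> 'a list set" where
  "word_factors w n = {map w [i..<i + n] | i. True}"

definition sturmian_word :: "(nat \<Rightarrow> nat) \<Rightarrow> bool" where
  "sturmian_word w \<longleftrightarrow> (\<forall>i. w i \<in> {0, 1}) \<and> (\<forall>n. card (word_factors w n) = n + 1)"

definition admissible_steps :: "(nat \<Rightarrow> nat) \<Rightarrow> real \<Rightarrow> real \<Rightarrow> bool" where
  "admissible_steps w x y \<longleftrightarrow> x > 0 \<and> y > 0 \<and>
     (\<forall>n. \<forall>u\<in>word_factors w n. u \<noteq> [] \<longrightarrow>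
        real (count_list u 0) * x \<noteq> real (count_list u 1) * y)"

primrec walk :: "(nat \<Rightarrow> nat) \<Rightarrow> real \<Rightarrow> real \<Rightarrow> real \<Rightarrow> nat \<Rightarrow> real" where
  "walk w x y a0 0 = a0"
| "walk w x y a0 (Suc i) = (if w i = 0 then walk w x y a0 i + x else walk w x y a0 i - y)"

definition sturmian_permutation :: "(nat \<Rightarrow> real) set \<Rightarrow> bool" where
  "sturmian_permutation \<alpha> \<longleftrightarrow>
     (\<exists>w x y a0. sturmian_word w \<and> admissible_steps w x y \<and>
        \<alpha> = perm_class UNIV (walk w x y a0))"

lemma walk_diff:
  assumes "\<forall>i. w i \<in> {0, 1}"
  shows "walk w x y a0 (i + n) = walk w x y a0 i +
    real (count_list (map w [i..<i + n]) 0) * x - real (count_list (map w [i..<i + n]) 1) * y"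
proof (induction n)
  case (Suc n)
  have "w (i + n) = 0 \<or> w (i + n) = 1" using assms by auto
  then show ?case using Suc by (auto simp: algebra_simps)
qed simp

lemma inj_walk:
  assumes "sturmian_word w" "admissible_steps w x y"
  shows "inj (walk w x y a0)"
proof (rule linorder_injI)
  fix i j :: nat assume "i < j"
  then obtain n where n: "j = i + n" "n > 0" by (metis less_imp_add_positive)
  let ?u = "map w [i..<i + n]"
  have "?u \<in> word_factors w n" "?u \<noteq> []" using n by (auto simp: word_factors_def)
  then have "real (count_list ?u 0) * x \<noteq> real (count_list ?u 1) * y"
    using assms(2) by (auto simp: admissible_steps_def simp del: map_is_Nil_conv)
  then show "walk w x y a0 i \<noteq> walk w x y a0 j"
    unfolding n(1) using walk_diff[of w x y a0 i n] assms(1) by (auto simp: sturmian_word_def)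
qed

lemma sturmian_permutation_in_perms: "sturmian_permutation \<alpha> \<Longrightarrow> \<alpha> \<in> perms UNIV"
  by (auto simp: sturmian_permutation_def intro: perm_class_in_perms inj_walk)

end

theory Submission
  imports Defs
begin

text \<open>
  Let \<open>L j\<close> be the number of ones among the first \<open>j\<close> letters of the Sturmian word.  The word is
  balanced, so it has a slope \<open>s\<close>, and since it is not eventually periodic the values
  \<open>g j = L j - j s\<close> lie at mutual distance less than \<open>1\<close>.  If \<open>t0\<close> minimises \<open>g (n + t)\<close> over
  \<open>t \<in> T\<close>, then \<open>L (n + t) - L (n + t0) = \<lceil>(t - t0) s\<rceil>\<close>, so \<open>t0\<close> alone determines the \<open>T\<close>-factor
  at \<open>n\<close>; there are at most \<open>card T\<close> of them, whatever the step lengths.  Equality holds for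
  \<open>T = {0, \<dots>, n - 1}\<close>, where a factor determines the factor of length \<open>n - 1\<close> of the word.
\<close>

text \<open>\<open>g\<close> factors through \<open>f\<close>. The upper bound takes the position of
  the minimum for \<open>f\<close> and the permutation factor for \<open>g\<close>; the lower bound
  takes the permutation factor for \<open>f\<close> and the word factor for
  \<open>g\<close>.\<close>

lemma card_range_le_if_determined:
  assumes "\<And>i j. f i = f j \<Longrightarrow> g i = g j" "finite (range f)"
  shows "card (range g) \<le> card (range f)"
proof -
  have "g i = g (SOME j. f j = f i)" for i
    by (rule assms(1)) (metis (mono_tags, lifting) someI)
  then have "range g = (\<lambda>z. g (SOME j. f j = z)) ` range f"
    by (auto simp: image_image)
  then show ?thesis using card_image_le[OF assms(2)] by simp
qed

subsection \<open>Factors of words\<close>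

definition factor_at :: "(nat \<Rightarrow> 'a) \<Rightarrow> nat \<Rightarrow> nat \<Rightarrow> 'a list" where
  "factor_at w n i = map w [i..<i + n]"

lemma word_factors_eq_range: "word_factors w n = range (factor_at w n)"
  by (auto simp: word_factors_def factor_at_def)

lemma factor_at_eq_iff: "factor_at w n i = factor_at w n j \<longleftrightarrow> (\<forall>m<n. w (i + m) = w (j + m))"
  by (auto simp: factor_at_def list_eq_iff_nth_eq)

lemma factor_at_Suc: "factor_at w (Suc n) i = factor_at w n i @ [w (i + n)]"
  by (simp add: factor_at_def)

lemma factor_at_Suc_Cons: "factor_at w (Suc n) i = w i # factor_at w n (Suc i)"
  by (simp add: factor_at_def upt_conv_Cons del: upt_Suc)

definition eventually_periodic :: "(nat \<Rightarrow> 'a) \<Rightarrow> bool" where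
  "eventually_periodic w \<longleftrightarrow> (\<exists>N d. d > 0 \<and> (\<forall>i\<ge>N. w (i + d) = w i))"

text \<open>Moving a position \<open>i \<ge> N + d\<close> back by \<open>d\<close> leaves its
  factor unchanged, so the first \<open>N + d\<close> positions already show every factor.\<close>

lemma card_word_factors_eventually_periodic:
  assumes "d > 0" "\<And>i. i \<ge> N \<Longrightarrow> w (i + d) = w i"
  shows "card (word_factors w n) \<le> N + d"
proof -
  have "factor_at w n i \<in> factor_at w n ` {..<N + d}" for i
  proof (induction i rule: less_induct)
    case (less i)
    show ?case
    proof (cases "i < N + d")
      case False
      have "factor_at w n i = factor_at w n (i - d)"
        unfolding factor_at_eq_iff
      proof (intro allI impI)
        fix m
        show "w (i + m) = w (i - d + m)"
          using assms(2)[of "i - d + m"] False by (simp add: algebra_simps)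
      qed
      then show ?thesis using less[of "i - d"] False assms(1) by simp
    qed simp
  qed
  then have "word_factors w n \<subseteq> factor_at w n ` {..<N + d}"
    by (auto simp: word_factors_eq_range)
  then have "card (word_factors w n) \<le> card (factor_at w n ` {..<N + d})"
    by (intro card_mono) auto
  also have "\<dots> \<le> N + d" using card_image_le[of "{..<N + d}"] by simp
  finally show ?thesis .
qed

lemma sturmian_word_letter: "sturmian_word w \<Longrightarrow> w i = 0 \<or> w i = 1"
  by (auto simp: sturmian_word_def)

lemma card_range_factor_at: "sturmian_word w \<Longrightarrow> card (range (factor_at w n)) = n + 1"
  by (simp add: sturmian_word_def word_factors_eq_range[symmetric])

lemma finite_range_factor_at: "sturmian_word w \<Longrightarrow> finite (range (factor_at w n))"
  by (rule card_ge_0_finite) (simp add: card_range_factor_at)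

lemma sturmian_not_eventually_periodic:
  assumes "sturmian_word w"
  shows "\<not> eventually_periodic w"
proof
  assume "eventually_periodic w"
  then obtain N d where d: "d > 0" and N: "\<And>i. i \<ge> N \<Longrightarrow> w (i + d) = w i"
    by (auto simp: eventually_periodic_def)
  have "card (word_factors w (N + d)) \<le> N + d"
    using d N by (rule card_word_factors_eventually_periodic)
  with assms show False by (simp add: sturmian_word_def)
qed

section \<open>Right special factors\<close>

definition right_special :: "(nat \<Rightarrow> 'a) \<Rightarrow> nat \<Rightarrow> 'a list \<Rightarrow> bool" where
  "right_special w n v \<longleftrightarrow>
     (\<exists>i j. factor_at w n i = v \<and> factor_at w n j = v \<and> w (i + n) \<noteq> w (j + n))"

text \<open>Every factor of length \<open>n\<close> has an extension to length \<open>Suc n\<close>,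
  and each right special one has a second. Going from \<open>n + 1\<close> to \<open>n + 2\<close>
  factors leaves room for only one surplus extension.\<close>

lemma right_special_unique:
  assumes "sturmian_word w" "right_special w n u" "right_special w n v"
  shows "u = v"
proof (rule ccontr)
  assume "u \<noteq> v"
  let ?F = "range (factor_at w n)" and ?G = "range (factor_at w (Suc n))"
  define e where "e x = w ((SOME i. factor_at w n i = x) + n)" for x
  have e: "x @ [e x] \<in> ?G" if "x \<in> ?F" for x
  proof -
    from that have "factor_at w n (SOME i. factor_at w n i = x) = x"
      by (metis (mono_tags, lifting) imageE someI)
    then show ?thesis by (metis e_def factor_at_Suc rangeI)
  qed
  have other: "\<exists>c. c \<noteq> e x \<and> x @ [c] \<in> ?G" if x: "right_special w n x" for x
  proof -
    obtain i j where ij: "factor_at w n i = x" "factor_at w n j = x" "w (i + n) \<noteq> w (j + n)"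
      using x unfolding right_special_def by blast
    then have "x @ [w (i + n)] \<in> ?G" "x @ [w (j + n)] \<in> ?G"
      by (metis factor_at_Suc rangeI)+
    then show ?thesis using ij(3) by metis
  qed
  obtain c d where c: "c \<noteq> e u" "u @ [c] \<in> ?G" and d: "d \<noteq> e v" "v @ [d] \<in> ?G"
    using other[OF assms(2)] other[OF assms(3)] by blast
  let ?E = "(\<lambda>x. x @ [e x]) ` ?F"
  have "card ?E = n + 1"
    by (subst card_image) (auto simp: inj_on_def card_range_factor_at[OF assms(1)])
  moreover have "u @ [c] \<notin> ?E" "v @ [d] \<notin> insert (u @ [c]) ?E"
    using c d \<open>u \<noteq> v\<close> by auto
  ultimately have "n + 3 = card (insert (v @ [d]) (insert (u @ [c]) ?E))"
    using finite_range_factor_at[OF assms(1)] by simp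
  also have "\<dots> \<le> card ?G"
    by (rule card_mono[OF finite_range_factor_at[OF assms(1)]]) (use c d e in auto)
  finally show False by (simp add: card_range_factor_at[OF assms(1)])
qed

text \<open>Both occurrences keep their continuations when the first letter is dropped. With
  uniqueness this pins down the tail of every right special factor.\<close>

lemma right_special_tail:
  assumes "right_special w (Suc n) (factor_at w (Suc n) i)"
  shows "right_special w n (factor_at w n (Suc i))"
proof -
  obtain j k where *: "factor_at w (Suc n) j = factor_at w (Suc n) i"
    "factor_at w (Suc n) k = factor_at w (Suc n) i" "w (j + Suc n) \<noteq> w (k + Suc n)"
    using assms by (auto simp: right_special_def)
  then have "factor_at w n (Suc j) = factor_at w n (Suc i)"
    "factor_at w n (Suc k) = factor_at w n (Suc i)"
    by (simp_all add: factor_at_Suc_Cons)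
  with *(3) show ?thesis unfolding right_special_def
    by (intro exI[of _ "Suc j"] exI[of _ "Suc k"]) simp
qed

text \<open>
  Between the two occurrences no factor has a choice of continuation, so the word cycles forever.
\<close>

lemma eventually_periodic_if_no_right_special:
  assumes "d > 0" "factor_at w n (p + d) = factor_at w n p"
    and "\<And>q. q < d \<Longrightarrow> \<not> right_special w n (factor_at w n (p + q))"
  shows "eventually_periodic w"
proof -
  \<comment> \<open>The second conjunct confines the factor at \<open>i\<close> to the
    \<open>d\<close> non-special ones, so that its next letter is forced.\<close>
  have step: "factor_at w n (i + d) = factor_at w n i \<and>
      (\<exists>q<d. factor_at w n i = factor_at w n (p + q))" if "i \<ge> p" for i
    using that
  proof (induction i rule: dec_induct)
    case base
    then show ?case using assms(1,2) by (metis add_0_right)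
  next
    case (step i)
    then obtain q where q: "q < d" "factor_at w n i = factor_at w n (p + q)" by auto
    have next_eq: "factor_at w n (Suc j) = factor_at w n (Suc i)"
      if "factor_at w n j = factor_at w n i" for j
    proof -
      from that q assms(3)[OF q(1)] have "w (j + n) = w (i + n)"
        by (metis right_special_def)
      with that have "factor_at w (Suc n) j = factor_at w (Suc n) i"
        by (simp add: factor_at_Suc)
      then show ?thesis by (simp add: factor_at_Suc_Cons)
    qed
    have "factor_at w n (Suc i) = factor_at w n (p + Suc q)"
      using next_eq[of "p + q"] q by simp
    moreover have "\<exists>q'<d. factor_at w n (p + Suc q) = factor_at w n (p + q')"
    proof (cases "Suc q = d")
      case True
      then show ?thesis using assms(1,2) by (metis add_0_right)
    next
      case False
      then show ?thesis using q by (metis Suc_lessI)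
    qed
    ultimately show ?case using next_eq[of "i + d"] step by auto
  qed
  have "w (i + d) = w i" if "i \<ge> p" for i
  proof (cases n)
    case (Suc m)
    then show ?thesis using step[OF that] by (auto simp: factor_at_eq_iff)
  next
    \<comment> \<open>Equal factors of length 0 carry no letter; here the empty word not being right
      special makes \<open>w\<close> constant.\<close>
    case 0
    then have "\<not> right_special w 0 []" using assms(3)[of 0] assms(1) by (simp add: factor_at_def)
    then show ?thesis by (simp add: right_special_def factor_at_def)
  qed
  then show ?thesis using assms(1) unfolding eventually_periodic_def by blast
qed

subsection \<open>Balance\<close>

text \<open>Integer valued, so that the count of ones in a block is a genuine difference of two
  prefix counts.\<close>

definition ones :: "(nat \<Rightarrow> nat) \<Rightarrow> nat \<Rightarrow> int" where
  "ones w n = (\<Sum>k<n. int (w k))"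

lemma ones_0 [simp]: "ones w 0 = 0"
  and ones_Suc [simp]: "ones w (Suc n) = ones w n + int (w n)"
  by (simp_all add: ones_def)

text \<open>Stated for a single length \<open>d\<close>, so that a shortest unbalanced length can be
  chosen. One inequality suffices because \<open>i\<close> and \<open>j\<close> may be
  swapped.\<close>

definition balanced :: "(nat \<Rightarrow> nat) \<Rightarrow> nat \<Rightarrow> bool" where
  "balanced w d \<longleftrightarrow> (\<forall>i j. ones w (i + d) - ones w i \<le> ones w (j + d) - ones w j + 1)"

lemma balancedD: "balanced w d \<Longrightarrow> ones w (i + d) - ones w i \<le> ones w (j + d) - ones w j + 1"
  by (auto simp: balanced_def)

text \<open>A shortest unbalanced pair consists of \<open>1u1\<close> and \<open>0u0\<close> with
  \<open>u\<close> a palindrome: the excess of ones must rise to 1 at the first letter, stay there,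
  and rise again at the last.\<close>

lemma minimal_unbalanced:
  assumes letter: "\<And>i. w i = 0 \<or> w i = 1"
    and "\<not> balanced w d" and minimal: "\<And>e. e < d \<Longrightarrow> balanced w e"
  obtains n i j where "w i = 1" "w (i + Suc n) = 1" "w j = 0" "w (j + Suc n) = 0"
    "\<And>m. 0 < m \<Longrightarrow> m \<le> n \<Longrightarrow> w (i + m) = w (j + m)"
    "\<And>m. 0 < m \<Longrightarrow> m \<le> n \<Longrightarrow> w (i + m) = w (i + (Suc n - m))"
proof -
  obtain i j where ij: "ones w (i + d) - ones w i > ones w (j + d) - ones w j + 1"
    using assms(2) by (auto simp: balanced_def not_le)
  define D where "D m = (ones w (i + m) - ones w i) - (ones w (j + m) - ones w j)" for m
  have D0: "D 0 = 0" by (simp add: D_def)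
  have DS: "D (Suc m) = D m + int (w (i + m)) - int (w (j + m))" for m by (simp add: D_def)
  have Dd: "D d \<ge> 2" using ij by (simp add: D_def)
  have Dle: "D m \<le> 1" if "m < d" for m
    using balancedD[OF minimal[OF that], of i j] by (simp add: D_def)
  \<comment> \<open>Balance of the shorter prefixes gave \<open>Dle\<close>; balance of the shorter
    suffixes gives this bound.\<close>
  have Dge: "D m \<ge> 1" if "0 < m" "m < d" for m
  proof -
    have "balanced w (d - m)" using that by (intro minimal) auto
    from balancedD[OF this, of "i + m" "j + m"] that have "D d - D m \<le> 1"
      by (simp add: D_def)
    then show ?thesis using Dd by simp
  qed
  have "d \<noteq> 0" using Dd D0 by (metis not_numeral_le_zero)
  moreover have "d \<noteq> 1"
    using Dd D0 DS[of 0] letter[of i] letter[of j] by auto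
  \<comment> \<open>\<open>n\<close> is the length of the common inner word
    \<open>u\<close>.\<close>
  ultimately obtain n where n: "d = Suc (Suc n)" by (metis One_nat_def not0_implies_Suc)
  have D1: "D m = 1" if "0 < m" "m \<le> Suc n" for m
    using Dle[of m] Dge[of m] that n by simp
  have "w i = 1" "w j = 0"
    using DS[of 0] D0 D1[of 1] letter[of i] letter[of j] by auto
  moreover have "w (i + Suc n) = 1" "w (j + Suc n) = 0"
    using DS[of "Suc n"] D1[of "Suc n"] Dd n letter[of "i + Suc n"] letter[of "j + Suc n"] by auto
  moreover have mid: "w (i + m) = w (j + m)" if "0 < m" "m \<le> n" for m
    using DS[of m] D1[of m] D1[of "Suc m"] that by simp
  moreover have "w (i + m) = w (i + (Suc n - m))" if "0 < m" "m \<le> n" for m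
    using that
  proof (induction m rule: less_induct)
    case (less m)
    text \<open>
      If the mirror images differ at \<open>m\<close> for the first time, then a prefix \<open>c v c\<close> and a suffix
      \<open>c' v\<^sup>R c'\<close> of length \<open>m + 1\<close> already violate balance.
    \<close>
    have rev: "ones w (i + Suc k) - ones w (Suc i) = ones w (i + Suc n) - ones w (i + (Suc n - k))"
      if "k < m" for k using that
    proof (induction k)
      case (Suc k)
      have "w (i + Suc k) = w (i + (Suc n - Suc k))" 
        using less.IH[of "Suc k"] less.prems Suc.prems by simp
      moreover have "i + (Suc n - k) = Suc (i + (Suc n - Suc k))" using Suc.prems less.prems by simp
      ultimately show ?case using Suc by simp
    qed simp
    have shift: "ones w (i + Suc k) - ones w (Suc i) = ones w (j + Suc k) - ones w (Suc j)"
      if "k \<le> n" for k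
      using that
    proof (induction k)
      case (Suc k)
      then show ?case using mid[of "Suc k"] by simp
    qed simp
    obtain m' where m': "m = Suc m'" using less.prems by (cases m) auto
    have "balanced w (Suc m)" using less.prems n by (intro minimal) simp
    note bal = balancedD[OF this]
    define k where "k = Suc n - m"
    have k: "k + m = Suc n" "0 < k" "k \<le> n" using less.prems by (auto simp: k_def)
    have kS: "Suc k = Suc n - m'" using k m' by simp
    have r: "ones w (i + Suc m') - ones w (Suc i) = ones w (i + Suc n) - ones w (i + Suc k)"
      using rev[of m'] m' unfolding kS by simp
    have s1: "ones w (i + Suc m') - ones w (Suc i) = ones w (j + Suc m') - ones w (Suc j)"
      using shift[of m'] m' less.prems by simp
    have s2: "ones w (i + Suc n) - ones w (i + Suc k) = ones w (j + Suc n) - ones w (j + Suc k)"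
      using shift[of n] shift[of k] k by simp
    have e: "i + k + Suc m = i + Suc (Suc n)" "j + k + Suc m = j + Suc (Suc n)"
      using k by simp_all
    have "w (i + m) = w (i + k)"
    proof (rule ccontr)
      assume ne: "w (i + m) \<noteq> w (i + k)"
      consider "w (i + m) = 1" "w (i + k) = 0" | "w (i + m) = 0" "w (i + k) = 1"
        using ne letter[of "i + m"] letter[of "i + k"] by auto
      then show False
      proof cases
        case 1
        then have "w (j + k) = 0" using mid[of k] k by simp
        then show False
          using bal[of i "j + k"] 1 r s1 s2 \<open>w i = 1\<close> \<open>w (j + Suc n) = 0\<close> m' unfolding e by simp
      next
        case 2
        then have "w (j + m) = 0" using mid[of m] less.prems by simp
        then show False
          using bal[of "i + k" j] 2 r s1 s2 \<open>w j = 0\<close> \<open>w (i + Suc n) = 1\<close> m' unfolding e by simp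
      qed
    qed
    then show ?case by (simp add: k_def)
  qed
  ultimately show thesis using that by blast
qed

text \<open>
  Of the words \<open>0u\<close> and \<open>1u\<close> at most one is right special.  If \<open>cu\<close> is the one that is not, the
  palindromicity of \<open>u\<close> keeps the other one out of the continuation of \<open>cuc\<close> for long enough to
  force a repetition among non-special factors.
\<close>

lemma sturmian_no_two_extensions:
  assumes "sturmian_word w"
    and p: "w p = c" "w (p + Suc n) = c" and "c' \<noteq> c" and q: "w q = c'"
    and mid: "\<And>m. 0 < m \<Longrightarrow> m \<le> n \<Longrightarrow> w (q + m) = w (p + m)"
    and pal: "\<And>m. 0 < m \<Longrightarrow> m \<le> n \<Longrightarrow> w (p + m) = w (p + (Suc n - m))"
    and special: "right_special w n (factor_at w n (Suc p))"
    and not_special: "\<not> right_special w (Suc n) (factor_at w (Suc n) p)"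
  shows False
proof -
  let ?W = "factor_at w (Suc n)"
  \<comment> \<open>An occurrence of \<open>c'u\<close> at offset \<open>k\<close> would read the
    final \<open>c\<close> of \<open>cuc\<close> as letter \<open>Suc n - k\<close> of
    \<open>u\<close>, whose mirror image is the letter \<open>c'\<close> at offset
    \<open>k\<close>.\<close>
  have avoid: "?W (p + k) \<noteq> ?W q" if k: "k \<le> Suc n" for k
  proof
    assume "?W (p + k) = ?W q"
    then have eq: "w (p + k + m) = w (q + m)" if "m \<le> n" for m
      using that by (auto simp: factor_at_eq_iff less_Suc_eq_le)
    have c': "w (p + k) = c'" using eq[of 0] q by simp
    then have "k \<noteq> 0" "k \<noteq> Suc n" using p \<open>c' \<noteq> c\<close> by (metis add_0_right)+
    then have k': "0 < k" "k \<le> n" using k by auto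
    have "c = w (p + k + (Suc n - k))" using p(2) k by simp
    also have "\<dots> = w (q + (Suc n - k))" using k' by (intro eq) simp
    also have "\<dots> = w (p + (Suc n - k))" using k' by (intro mid) auto
    also have "\<dots> = c'" using pal[of k] k' c' by simp
    finally show False using \<open>c' \<noteq> c\<close> by simp
  qed
  \<comment> \<open>A right special factor of length \<open>Suc n\<close> has the special tail
    \<open>u\<close>, so it is \<open>cu\<close> or \<open>c'u\<close>; the first is not special and
    the second is avoided.\<close>
  have non: "\<not> right_special w (Suc n) (?W (p + k))" if k: "k \<le> Suc n" for k
  proof
    assume "right_special w (Suc n) (?W (p + k))"
    then have "factor_at w n (Suc (p + k)) = factor_at w n (Suc p)"
      "right_special w (Suc n) (?W (p + k))"
      using right_special_tail right_special_unique[OF assms(1)] special by blast+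
    then have tail: "w (p + k + m) = w (p + m)" if "0 < m" "m \<le> n" for m
      using that unfolding factor_at_eq_iff by (cases m) auto
    have "w (p + k) = c \<or> w (p + k) = c'"
      using sturmian_word_letter[OF assms(1)] \<open>c' \<noteq> c\<close> p(1) q by metis
    moreover have "?W (p + k) = ?W r"
      if "w (p + k) = w r" "\<And>m. 0 < m \<Longrightarrow> m \<le> n \<Longrightarrow> w (r + m) = w (p + m)" for r
      unfolding factor_at_eq_iff
    proof (intro allI impI)
      fix m assume "m < Suc n"
      then show "w (p + k + m) = w (r + m)" using that tail[of m] by (cases "m = 0") auto
    qed
    ultimately have "?W (p + k) = ?W p \<or> ?W (p + k) = ?W q"
      using p(1) q mid by metis
    then show False
      using not_special avoid[OF k] \<open>right_special w (Suc n) (?W (p + k))\<close> by metis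
  qed
  \<comment> \<open>Pigeonhole: there are \<open>n + 2\<close> offsets, but missing
    \<open>c'u\<close> leaves at most \<open>n + 1\<close> of the \<open>n + 2\<close> factors of
    length \<open>Suc n\<close>.\<close>
  have "\<not> inj_on (\<lambda>k. ?W (p + k)) {..Suc n}"
  proof
    assume "inj_on (\<lambda>k. ?W (p + k)) {..Suc n}"
    then have "card ((\<lambda>k. ?W (p + k)) ` {..Suc n}) = n + 2" by (simp add: card_image)
    moreover have "?W q \<notin> (\<lambda>k. ?W (p + k)) ` {..Suc n}" using avoid by force
    ultimately have "n + 3 = card (insert (?W q) ((\<lambda>k. ?W (p + k)) ` {..Suc n}))" by simp
    also have "\<dots> \<le> card (range ?W)"
      by (rule card_mono[OF finite_range_factor_at[OF assms(1)]]) auto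
    finally show False by (simp add: card_range_factor_at[OF assms(1)])
  qed
  then obtain k l where kl: "k < l" "l \<le> Suc n" "?W (p + k) = ?W (p + l)"
    unfolding inj_on_def by (metis atMost_iff linorder_neqE_nat)
  have "eventually_periodic w"
  proof (rule eventually_periodic_if_no_right_special)
    show "l - k > 0" using kl by simp
    show "?W (p + k + (l - k)) = ?W (p + k)" using kl by simp
    show "\<not> right_special w (Suc n) (?W (p + k + r))" if "r < l - k" for r
      using non[of "k + r"] that kl by (simp add: add.assoc)
  qed
  then show False using sturmian_not_eventually_periodic[OF assms(1)] by simp
qed

text \<open>A shortest imbalance makes \<open>u\<close> right special, being followed by both
  letters. By uniqueness \<open>0u\<close> and \<open>1u\<close> are not both right special, and
  either non-special one leads to a contradiction.\<close>

theorem sturmian_balanced: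
  assumes "sturmian_word w"
  shows "balanced w d"
proof (rule ccontr)
  assume "\<not> balanced w d"
  define d' where "d' = (LEAST d. \<not> balanced w d)"
  have "\<not> balanced w d'" unfolding d'_def by (rule LeastI) fact
  moreover have "balanced w e" if "e < d'" for e using that not_less_Least d'_def by blast
  ultimately obtain n i j where ij: "w i = 1" "w (i + Suc n) = 1" "w j = 0" "w (j + Suc n) = 0"
    and mid: "\<And>m. 0 < m \<Longrightarrow> m \<le> n \<Longrightarrow> w (i + m) = w (j + m)"
    and pal: "\<And>m. 0 < m \<Longrightarrow> m \<le> n \<Longrightarrow> w (i + m) = w (i + (Suc n - m))"
    by (rule minimal_unbalanced[OF sturmian_word_letter[OF assms]]) (assumption, rule that)
  have pal': "w (j + m) = w (j + (Suc n - m))" if "0 < m" "m \<le> n" for m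
    using pal[of m] mid[of m] mid[of "Suc n - m"] that by simp
  have tails: "factor_at w n (Suc i) = factor_at w n (Suc j)"
    using mid[of "Suc _"] by (auto simp: factor_at_eq_iff)
  have special: "right_special w n (factor_at w n (Suc i))"
    unfolding right_special_def
    by (intro exI[of _ "Suc i"] exI[of _ "Suc j"]) (use ij tails in simp)
  have "factor_at w (Suc n) i \<noteq> factor_at w (Suc n) j"
    using ij by (auto simp: factor_at_eq_iff)
  then consider "\<not> right_special w (Suc n) (factor_at w (Suc n) i)"
    | "\<not> right_special w (Suc n) (factor_at w (Suc n) j)"
    using right_special_unique[OF assms] by blast
  then show False
  proof cases
    case 1
    show False
      by (rule sturmian_no_two_extensions[OF assms ij(1,2) _ ij(3) mid[symmetric] pal special 1])
        auto
  next
    case 2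
    show False
      by (rule sturmian_no_two_extensions[OF assms ij(3,4) _ ij(1) mid pal' _ 2])
        (use special tails in auto)
  qed
qed

subsection \<open>The slope\<close>

lemma ones_blocks_ge:
  assumes "\<And>i. ones w (i + d) - ones w i \<ge> c"
  shows "ones w (q * d) \<ge> int q * c"
proof (induction q)
  case (Suc q)
  then show ?case using assms[of "q * d"] by (simp add: algebra_simps)
qed simp

lemma ones_blocks_le:
  assumes "\<And>i. ones w (i + d) - ones w i \<le> c"
  shows "ones w (q * d) \<le> int q * c"
proof (induction q)
  case (Suc q)
  then show ?case using assms[of "q * d"] by (simp add: algebra_simps)
qed simp

text \<open>The slope is the supremum of the lower estimates (count - 1)/length; no lower estimate
  exceeds an upper estimate (count + 1)/length.\<close>

lemma balanced_slope:
  assumes "\<And>d. balanced w d"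
  obtains s :: real
  where "\<And>i j. \<bar>(real_of_int (ones w i) - real i * s) - (real_of_int (ones w j) - real j * s)\<bar> \<le> 1"
proof -
  define A where "A = {real_of_int (ones w (i + d) - ones w i - 1) / real d | i d. d > 0}"
  have ub: "z \<le> real_of_int (ones w (j + e) - ones w j + 1) / real e" if "z \<in> A" "e > 0" for z j e
  proof -
    obtain i d where z: "z = real_of_int (ones w (i + d) - ones w i - 1) / real d" "d > 0"
      using \<open>z \<in> A\<close> by (auto simp: A_def)
    \<comment> \<open>The prefix of length \<open>d * e\<close> is cut once into \<open>e\<close>
      blocks of length \<open>d\<close> and once into \<open>d\<close> blocks of length
      \<open>e\<close>.\<close>
    have "int e * (ones w (i + d) - ones w i - 1) \<le> ones w (e * d)"
      by (rule ones_blocks_ge) (use balancedD[OF assms, of i d] in \<open>simp add: algebra_simps\<close>)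
    also have "\<dots> = ones w (d * e)" by (simp add: mult.commute)
    also have "\<dots> \<le> int d * (ones w (j + e) - ones w j + 1)"
      by (rule ones_blocks_le) (use balancedD[OF assms, of _ e j] in \<open>simp add: algebra_simps\<close>)
    finally have "real_of_int (int e * (ones w (i + d) - ones w i - 1))
        \<le> real_of_int (int d * (ones w (j + e) - ones w j + 1))"
      by (simp only: of_int_le_iff)
    then have "real e * real_of_int (ones w (i + d) - ones w i - 1)
        \<le> real d * real_of_int (ones w (j + e) - ones w j + 1)"
      by (simp only: of_int_mult of_int_of_nat_eq)
    moreover have "a / p \<le> b / q" if "q * a \<le> p * b" "p > 0" "q > 0" for a b p q :: real
      using that by (simp add: field_simps)
    ultimately show ?thesis unfolding z(1) using z(2) that(2) by simp
  qed
  have "A \<noteq> {}" by (auto simp: A_def)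
  have "bdd_above A" using ub[of _ 1 0] by (meson bdd_aboveI zero_less_one)
  define s where "s = Sup A"
  have s: "real_of_int (ones w (i + d) - ones w i - 1) \<le> real d * s"
    "real d * s \<le> real_of_int (ones w (i + d) - ones w i + 1)" for i d
  proof -
    show "real_of_int (ones w (i + d) - ones w i - 1) \<le> real d * s"
    proof (cases "d = 0")
      case False
      then have "real_of_int (ones w (i + d) - ones w i - 1) / real d \<le> s"
        unfolding s_def by (intro cSup_upper \<open>bdd_above A\<close>) (auto simp: A_def)
      then show ?thesis using False by (simp add: field_simps)
    qed simp
    show "real d * s \<le> real_of_int (ones w (i + d) - ones w i + 1)"
    proof (cases "d = 0")
      case False
      then have "s \<le> real_of_int (ones w (i + d) - ones w i + 1) / real d"
        unfolding s_def by (intro cSup_least \<open>A \<noteq> {}\<close> ub) auto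
      then show ?thesis using False by (simp add: field_simps)
    qed simp
  qed
  have le: "\<bar>(real_of_int (ones w i) - real i * s) - (real_of_int (ones w j) - real j * s)\<bar> \<le> 1"
    if le: "i \<le> j" for i j
  proof -
    obtain d where "j = i + d" using le by (auto simp: le_iff_add)
    then show ?thesis using s(1)[of i d] s(2)[of d i] by (simp add: algebra_simps abs_le_iff)
  qed
  have "\<bar>(real_of_int (ones w i) - real i * s) - (real_of_int (ones w j) - real j * s)\<bar> \<le> 1" for i j
    using le[of i j] le[of j i] by (cases "i \<le> j") (auto simp: abs_minus_commute)
  then show thesis by (rule that)
qed

section \<open>Strictness of the oscillation bound\<close>

text \<open>Along each residue class modulo \<open>d\<close> the values never decrease, so two
  increments there would break the oscillation bound. Hence there are at most \<open>d\<close>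
  increments in all when \<open>d > 0\<close>.\<close>

lemma eventually_constant_along_progressions:
  fixes h :: "nat \<Rightarrow> real"
  assumes osc: "\<And>i j. \<bar>h i - h j\<bar> \<le> 1"
    and incr: "\<And>j. h (j + d) = h j \<or> h (j + d) = h j + 1"
  obtains N where "\<And>j. j \<ge> N \<Longrightarrow> h (j + d) = h j"
proof -
  define M where "M = {j. h (j + d) = h j + 1}"
  have mono: "h j \<le> h (j + m * d)" for j m
  proof (induction m)
    case (Suc m)
    then show ?case using incr[of "j + m * d"] by (auto simp: algebra_simps)
  qed simp
  have "finite M"
  proof (cases "d = 0")
    case True
    then show ?thesis by (simp add: M_def)
  next
    case False
    have no: "j mod d \<noteq> k mod d" if "j \<in> M" "k \<in> M" "j < k" for j k
    proof
      assume "j mod d = k mod d"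
      then have "d dvd k - j" using that(3) by (metis less_imp_le mod_eq_dvd_iff_nat)
      then obtain r where "k - j = d * r" by (rule dvdE)
      then have r: "k = j + r * d" using that(3) by (simp add: mult.commute)
      with that(3) obtain m where "r = Suc m" by (cases r) auto
      then have "h (j + d) \<le> h k" using mono[of "j + d" m] r by (simp add: algebra_simps)
      moreover have "h (k + d) = h k + 1" "h (j + d) = h j + 1" using that by (auto simp: M_def)
      ultimately show False using osc[of "k + d" j] by simp
    qed
    then have "inj_on (\<lambda>j. j mod d) M" unfolding inj_on_def by (metis linorder_neqE_nat)
    moreover have "finite ((\<lambda>j. j mod d) ` M)"
      by (rule finite_subset[of _ "{..<d}"]) (use False in auto)
    ultimately show ?thesis by (rule finite_imageD[rotated])
  qed
  then obtain N where "\<And>j. j \<in> M \<Longrightarrow> j < N"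
    by (meson finite_nat_set_iff_bounded)
  then have "h (j + d) = h j" if "j \<ge> N" for j
    using incr[of j] that by (force simp: M_def)
  then show thesis by (rule that)
qed

lemma eventually_periodic_if_ones:
  assumes "d > 0" "\<And>j. j \<ge> N \<Longrightarrow> ones w (j + d) = ones w j + c"
  shows "eventually_periodic w"
proof -
  have "w (j + d) = w j" if "j \<ge> N" for j
    using assms(2)[of j] assms(2)[of "Suc j"] that by simp
  then show ?thesis using assms(1) unfolding eventually_periodic_def by blast
qed

text \<open>Balance gives the bound with \<open>\<le>\<close>; aperiodicity makes it strict, which
  later lets a ceiling determine the counts.\<close>

lemma sturmian_slope:
  assumes "sturmian_word w"
  obtains s :: real
  where "\<And>i j. \<bar>(real_of_int (ones w i) - real i * s) - (real_of_int (ones w j) - real j * s)\<bar> < 1"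
proof -
  obtain s :: real where le:
    "\<And>i j. \<bar>(real_of_int (ones w i) - real i * s) - (real_of_int (ones w j) - real j * s)\<bar> \<le> 1"
    by (rule balanced_slope[OF sturmian_balanced[OF assms]]) (rule that)
  define g where "g i = real_of_int (ones w i) - real i * s" for i
  have osc: "\<bar>g i - g j\<bar> \<le> 1" for i j using le by (simp add: g_def)
  note bal = balancedD[OF sturmian_balanced[OF assms]]
  text \<open>A difference of exactly \<open>\<plusminus>1\<close> makes \<open>d s\<close> an integer and the word eventually periodic.\<close>
  have no: "g (i + d) - g i \<noteq> 1 \<and> g (i + d) - g i \<noteq> - 1" for i d
  proof (rule ccontr)
    assume "\<not> ?thesis"
    then obtain e :: int where e: "g (i + d) - g i = real_of_int e" "e = 1 \<or> e = - 1"
      by (metis of_int_1 of_int_minus)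
    then have "d > 0" by (cases d) auto
    define K where "K = ones w (i + d) - ones w i - e"
    have K: "real d * s = real_of_int K" using e(1) by (simp add: g_def K_def algebra_simps)
    have diff: "g (j + d) - g j = real_of_int (ones w (j + d) - ones w j - K)" for j
      using K by (simp add: g_def algebra_simps)
    \<comment> \<open>The block at \<open>i\<close> has \<open>K + e\<close> ones, and balance
      allows a spread of only 1, which excludes \<open>K - e\<close>.\<close>
    have cases: "ones w (j + d) - ones w j - K = 0 \<or> ones w (j + d) - ones w j - K = e" for j
    proof -
      have "\<bar>ones w (j + d) - ones w j - K\<bar> \<le> 1"
        using osc[of "j + d" j] unfolding diff by linarith
      moreover have "ones w (j + d) - ones w j - K \<noteq> - e"
        using bal[of i d j] bal[of j d i] e(2) by (auto simp: K_def)
      ultimately show ?thesis using e(2) by auto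
    qed
    \<comment> \<open>Multiplying by the sign \<open>e\<close> turns every change into an increment
      by 1, so both signs are treated at once.\<close>
    have "\<bar>real_of_int e * g j - real_of_int e * g k\<bar> \<le> 1" for j k
      using osc[of j k] e(2) by auto
    moreover have "real_of_int e * g (j + d) = real_of_int e * g j
        \<or> real_of_int e * g (j + d) = real_of_int e * g j + 1" for j
      using cases[of j] diff[of j] e(2) by auto
    ultimately obtain N where "\<And>j. j \<ge> N \<Longrightarrow> real_of_int e * g (j + d) = real_of_int e * g j"
      by (rule eventually_constant_along_progressions[where h = "\<lambda>j. real_of_int e * g j"])
        (rule that)
    then have "ones w (j + d) = ones w j + K" if "j \<ge> N" for j
      using diff[of j] that e(2) by auto
    then show False
      using eventually_periodic_if_ones[OF \<open>d > 0\<close>] sturmian_not_eventually_periodic[OF assms]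
      by metis
  qed
  have lt: "\<bar>g i - g j\<bar> < 1" if le: "i \<le> j" for i j
  proof -
    obtain d where "j = i + d" using le by (auto simp: le_iff_add)
    then show ?thesis using no[of i d] osc[of i j] by (auto simp: abs_if split: if_splits)
  qed
  have "\<bar>g i - g j\<bar> < 1" for i j
    using lt[of i j] lt[of j i] by (cases "i \<le> j") (auto simp: abs_minus_commute)
  then show thesis using that unfolding g_def by blast
qed

subsection \<open>Sturmian permutations\<close>

lemma walk_eq_ones:
  assumes "\<And>i. w i = 0 \<or> w i = 1"
  shows "walk w x y a0 i = a0 + real i * x - real_of_int (ones w i) * (x + y)"
proof (induction i)
  case (Suc i)
  then show ?case using assms[of i] by (auto simp: algebra_simps)
qed simp

lemma perm_complexity_walk_le:
  assumes "sturmian_word w" "admissible_steps w x y" "finite T" "T \<noteq> {}"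
  shows "perm_complexity (perm_class UNIV (walk w x y a0)) T \<le> card T"
proof -
  let ?a = "walk w x y a0"
  obtain s :: real where s:
    "\<And>i j. \<bar>(real_of_int (ones w i) - real i * s) - (real_of_int (ones w j) - real j * s)\<bar> < 1"
    by (rule sturmian_slope[OF assms(1)]) (rule that)
  define g where "g i = real_of_int (ones w i) - real i * s" for i
  define F where "F n = perm_factor (perm_class UNIV ?a) T n" for n
  define t0 where "t0 n = arg_min_on (\<lambda>t. g (t + n)) T" for n
  have t0: "t0 n \<in> T" "\<And>t. t \<in> T \<Longrightarrow> g (t0 n + n) \<le> g (t + n)" for n
    unfolding t0_def using arg_min_if_finite[OF assms(3,4), of "\<lambda>t. g (t + n)"]
    by (auto simp: not_less)
  \<comment> \<open>\<open>g (t + n) - g (t0 n + n)\<close> lies in \<open>[0, 1)\<close> by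
    minimality and the strict bound, so the integer difference of counts is the ceiling. Any
    minimiser serves, so ties do no harm.\<close>
  have ones_eq: "ones w (t + n) = ones w (t0 n + n) + \<lceil>(real t - real (t0 n)) * s\<rceil>"
    if "t \<in> T" for t n
  proof -
    have "\<lceil>(real t - real (t0 n)) * s\<rceil> = ones w (t + n) - ones w (t0 n + n)"
      using t0(2)[OF that, of n] s[of "t + n" "t0 n + n"]
      by (intro ceiling_unique) (auto simp: g_def algebra_simps)
    then show ?thesis by simp
  qed
  have F_eq: "F n = F m" if "t0 n = t0 m" for n m
  proof -
    \<comment> \<open>The common term \<open>ones w (t0 n + n)\<close> cancels in differences,
      leaving only ceilings that depend on \<open>t0 n\<close>.\<close>
    have "?a (t + n) - ?a (r + n) = ?a (t + m) - ?a (r + m)" if "t \<in> T" "r \<in> T" for t r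
      unfolding walk_eq_ones[OF sturmian_word_letter[OF assms(1)]]
        ones_eq[OF that(1)] ones_eq[OF that(2)] \<open>t0 n = t0 m\<close>
      by (simp add: algebra_simps)
    then have "?a (t + n) < ?a (r + n) \<longleftrightarrow> ?a (t + m) < ?a (r + m)" if "t \<in> T" "r \<in> T" for t r
      using that by (metis diff_less_0_iff_less)
    then show ?thesis
      unfolding F_def perm_factor_perm_class[OF inj_walk[OF assms(1,2)]]
      by (subst perm_class_eq_iff) (auto intro: inj_on_shift inj_walk assms)
  qed
  have sub: "range t0 \<subseteq> T" using t0(1) by auto
  have "perm_complexity (perm_class UNIV ?a) T = card (range F)"
    unfolding perm_complexity_def F_def by (simp add: full_SetCompr_eq)
  also have "\<dots> \<le> card (range t0)"
    using F_eq finite_subset[OF sub assms(3)] by (rule card_range_le_if_determined)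
  also have "\<dots> \<le> card T" using assms(3) sub by (rule card_mono)
  finally show ?thesis .
qed

lemma perm_complexity_walk_ge:
  assumes "sturmian_word w" "admissible_steps w x y"
  shows "Suc n \<le> perm_complexity (perm_class UNIV (walk w x y a0)) {..<Suc n}"
proof -
  let ?a = "walk w x y a0" and ?T = "{..<Suc n}"
  define F where "F k = perm_factor (perm_class UNIV ?a) ?T k" for k
  have xy: "x > 0" "y > 0" using assms(2) unfolding admissible_steps_def by blast+
  \<comment> \<open>Comparing neighbours reads off a letter, so \<open>Suc n\<close> consecutive
    indices reveal \<open>n\<close> letters.\<close>
  then have step: "w k = 0 \<longleftrightarrow> ?a k < ?a (Suc k)" for k by simp
  have determined: "factor_at w n k = factor_at w n l" if "F k = F l" for k l
    unfolding factor_at_eq_iff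
  proof (intro allI impI)
    fix m assume "m < n"
    from that have "\<forall>t\<in>?T. \<forall>r\<in>?T. ?a (t + k) < ?a (r + k) \<longleftrightarrow> ?a (t + l) < ?a (r + l)"
      unfolding F_def perm_factor_perm_class[OF inj_walk[OF assms]]
      by (subst (asm) perm_class_eq_iff) (auto intro: inj_on_shift inj_walk assms)
    then have "?a (m + k) < ?a (Suc m + k) \<longleftrightarrow> ?a (m + l) < ?a (Suc m + l)"
      using \<open>m < n\<close> by (meson Suc_mono less_Suc_eq lessThan_iff)
    then have "w (m + k) = 0 \<longleftrightarrow> w (m + l) = 0" unfolding step by simp
    then show "w (k + m) = w (l + m)"
      using sturmian_word_letter[OF assms(1)] by (metis add.commute)
  qed
  have range: "{perm_factor (perm_class UNIV ?a) ?T k | k. True} = range F"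
    by (auto simp: F_def)
  have "finite (range F)"
    using perm_factors_bound(1)[OF perm_class_in_perms[OF inj_walk[OF assms]], of ?T a0] range
    by simp
  with determined have "card (range (factor_at w n)) \<le> card (range F)"
    by (rule card_range_le_if_determined)
  then show ?thesis
    unfolding perm_complexity_def range by (simp add: card_range_factor_at[OF assms(1)])
qed

theorem theorem5:
  fixes \<alpha> :: "(nat \<Rightarrow> real) set" and n :: nat
  assumes "sturmian_permutation \<alpha>" and "n \<ge> 1"
  shows "max_pattern_complexity \<alpha> n = n"
proof -
  obtain w x y a0 where w: "sturmian_word w" "admissible_steps w x y"
    and \<alpha>: "\<alpha> = perm_class UNIV (walk w x y a0)"
    using assms(1) by (auto simp: sturmian_permutation_def)
  let ?S = "{perm_complexity \<alpha> T | T. window T \<and> card T = n}"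
  have upper: "c \<le> n" if "c \<in> ?S" for c
    using that perm_complexity_walk_le[OF w] by (auto simp: \<alpha> window_def)
  obtain m where m: "n = Suc m" using assms(2) by (cases n) auto
  have "window {..<n}" "card {..<n} = n" using assms(2) by (auto simp: window_def)
  then have full: "perm_complexity \<alpha> {..<n} \<in> ?S" by blast
  \<comment> \<open>The interval window attains the upper bound, since words have
    \<open>m + 1 = n\<close> factors of length \<open>m\<close>.\<close>
  then have "perm_complexity \<alpha> {..<n} = n"
    using perm_complexity_walk_ge[OF w, of m a0] upper[OF full] by (simp add: \<alpha> m)
  with full have "n \<in> ?S" by simp
  then show ?thesis
    unfolding max_pattern_complexity_def
    using finite_perm_complexities[OF sturmian_permutation_in_perms[OF assms(1)]] upper
    by (intro Max_eqI)
qed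

end
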